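(* There exist an absolute constant $0<\eta<1$ and, for each integer $\ell\ge2$, a constant $C=C(\ell)$ depending only on $\ell$, such that the following holds. For any integers $2\le\ell\le s$ there are $\rho',\tau'$ depending only on $s,\ell$ such that for any $\Delta>0$ satisfying $\Delta<\frac{\pi}{2(\ell-1)}$ there exists a $(\Delta,\rho',s,\ell,\tau')$-clustered configuration $\boldsymbol{x}_{\min}$ with $s$ nodes for which $$\lambda_{\min}\left(\mathbf{G}(\boldsymbol{x}_{\min},\Omega)\right)\le C\cdot(\Delta\Omega)^{2(\ell-1)}\qquad\text{for all }\Omega>0\text{ with }\Delta\Omega<\eta.$$
   Context: Wrap-around distance: for $t\in\mathbb{R}$, $\|t\|_{\mathbb{T}}:=|\operatorname{Arg}\exp(\imath t)|=|t \bmod (-\pi,\pi]|$, where $\operatorname{Arg}$ takes values in $(-\pi,\pi]$. Clustered configuration: let $\Delta>0$, $2\le\ell\le s$, $\ell-1\le\tau<\pi/\Delta$, $\rho\ge 0$. A vector $\boldsymbol{x}=(t_1,\dots,t_s)$ of $s$ distinct nodes in $(-\frac{\pi}{2},\frac{\pi}{2}]$ forms a $(\Delta,\rho,s,\ell,\tau)$-clustered configuration if for each $t_j$ there exist at most $\ell$ distinct nodes $\boldsymbol{x}^{(j)}=\{t_{j,k}\}_{k=1,\dots,r_j}\subset\boldsymbol{x}$, $1\le r_j\le \ell$, $t_{j,1}\equiv t_j$, such that: (1) for any $y\in\boldsymbol{x}^{(j)}\setminus\{t_j\}$, $\Delta\le\|y-t_j\|_{\mathbb{T}}\le\tau\Delta$;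 (2) for any $y\in\boldsymbol{x}\setminus\boldsymbol{x}^{(j)}$, $\|y-t_j\|_{\mathbb{T}}\ge\rho$. $\mathbf{G}(\boldsymbol{x},\Omega)$ is the $s\times s$ matrix $[\operatorname{sinc}(\Omega(t_i-t_j))]_{1\le i,j\le s}$, where $\operatorname{sinc}(t)=\frac{\sin t}{t}$ for $t\ne0$ and $\operatorname{sinc}(0)=1$. $\lambda_{\min}$ denotes the minimal eigenvalue. *)

theory Defs
  imports "HOL-Probability.Sinc_Integral" "Jordan_Normal_Form.Spectral_Radius"
begin

definition wrap_norm :: "real \<Rightarrow> real" where
  "wrap_norm t = \<bar>Arg (exp (\<i> * complex_of_real t))\<bar>"

text \<open>
  The node vector is a list \<open>x\<close> of length \<open>s\<close>. The set \<open>K\<close> is the cluster of nodes attached to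
  the node \<open>t\<close>, including \<open>t\<close> itself. The standing constraints on the parameters are part of the
  predicate.
\<close>
definition clustered_configuration ::
  "real \<Rightarrow> real \<Rightarrow> nat \<Rightarrow> nat \<Rightarrow> real \<Rightarrow> real list \<Rightarrow> bool" where
  "clustered_configuration \<Delta> \<rho> s l \<tau> x \<longleftrightarrow>
     \<Delta> > 0 \<and> 2 \<le> l \<and> l \<le> s \<and> real l - 1 \<le> \<tau> \<and> \<tau> < pi / \<Delta> \<and> \<rho> \<ge> 0 \<and>
     length x = s \<and> distinct x \<and> set x \<subseteq> {- (pi / 2) <.. pi / 2} \<and>
     (\<forall>t \<in> set x. \<exists>K. K \<subseteq> set x \<and> t \<in> K \<and> card K \<le> l \<and>
        (\<forall>y \<in> K - {t}. \<Delta> \<le> wrap_norm (y - t) \<and> wrap_norm (y - t) \<le> \<tau> * \<Delta>) \<and>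
        (\<forall>y \<in> set x - K. wrap_norm (y - t) \<ge> \<rho>))"

definition sinc_matrix :: "real list \<Rightarrow> real \<Rightarrow> real Matrix.mat" where
  "sinc_matrix x \<Omega> =
     Matrix.mat (length x) (length x) (\<lambda>(i, j). sinc (\<Omega> * (x ! i - x ! j)))"

text \<open>
  For real symmetric matrices of positive dimension, such as those above with nonempty \<open>x\<close>, the
  real spectrum is finite and nonempty, so that the minimum exists.
\<close>
definition lambda_min :: "real Matrix.mat \<Rightarrow> real" where
  "lambda_min A = Min (spectrum A)"

end

theory Submission
  imports Defs
begin

text \<open>
  Since \<open>sinc y = \<integral>\<^sub>0\<^sup>1 cos (y u) du\<close>, the quadratic form of the matrix
  \<open>[sinc (\<Omega> (t\<^sub>i - t\<^sub>j))]\<close> at a vector \<open>c\<close> is the mean square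
  \<open>\<integral>\<^sub>0\<^sup>1 \<bar>\<Sum>\<^sub>k c\<^sub>k exp (\<i> \<Omega> t\<^sub>k u)\<bar>\<^sup>2 du\<close> of an exponential sum. If \<open>l\<close> of the nodes are equispaced,
  \<open>t\<^sub>k = k \<Delta>\<close>, and \<open>c\<close> is supported on them with \<open>c\<^sub>k = (-1) ^ k (l-1 choose k)\<close>, then the exponential
  sum is \<open>(1 - exp (\<i> \<Omega> \<Delta> u)) ^ (l - 1)\<close>, of modulus at most \<open>(\<Omega> \<Delta>) ^ (l - 1)\<close> because
  \<open>\<bar>1 - exp (\<i> \<phi>)\<bar> \<le> \<bar>\<phi>\<bar>\<close>. As \<open>\<bar>c\<bar> \<ge> \<bar>c\<^sub>0\<bar> = 1\<close>, the Rayleigh principle bounds the smallest eigenvalue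
  by \<open>(\<Omega> \<Delta>) ^ (2 (l - 1))\<close>, so \<open>C = 1\<close> works.

  The cluster \<open>0, \<Delta>, \<dots>, (l-1) \<Delta>\<close> lies in \<open>[0, \<pi>/2)\<close>. The remaining \<open>s - l\<close> nodes are isolated and
  placed at the multiples \<open>-\<rho>, -2\<rho>, \<dots>, -(s-l)\<rho>\<close> of \<open>\<rho> = \<pi> / (2 (s - l + 1))\<close>, which stay in
  \<open>(-\<pi>/2, 0)\<close>. All differences are then below \<open>\<pi>\<close> in modulus, so wrap-around distance is the usual
  distance, and the separation \<open>\<rho>\<close> is positive and independent of \<open>\<Delta>\<close>.

  The Rayleigh principle for real symmetric matrices is obtained from compactness of the unit
  sphere: the quadratic form attains a minimum \<open>\<mu>\<close> there, and subtracting \<open>\<mu>\<close> from the diagonal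
  leaves a positive semidefinite form that vanishes at the minimizer, which therefore is an
  eigenvector.
\<close>

section \<open>The Rayleigh principle for real symmetric matrices\<close>

text \<open>
  If \<open>r\<close> is the image of \<open>v\<close>, the form at \<open>v + t r\<close> is \<open>2 t \<bar>r\<bar>\<^sup>2 + O(t\<^sup>2)\<close>, which can only be
  nonnegative for small negative \<open>t\<close> when \<open>r = 0\<close>.
\<close>
lemma psd_form_zero_imp_kernel:
  fixes m :: "nat \<Rightarrow> nat \<Rightarrow> real"
  assumes sym: "\<And>i j. i < n \<Longrightarrow> j < n \<Longrightarrow> m i j = m j i"
    and psd: "\<And>w. 0 \<le> (\<Sum>i<n. \<Sum>j<n. m i j * (w i * w j))"
    and zero: "(\<Sum>i<n. \<Sum>j<n. m i j * (v i * v j)) = 0"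
    and "i < n"
  shows "(\<Sum>j<n. m i j * v j) = 0"
proof -
  define r where "r i = (\<Sum>j<n. m i j * v j)" for i
  define B where "B = (\<Sum>i<n. (r i)\<^sup>2)"
  define c where "c = (\<Sum>i<n. \<Sum>j<n. m i j * (r i * r j))"
  have B1: "(\<Sum>i<n. \<Sum>j<n. m i j * (r i * v j)) = B"
    unfolding B_def power2_eq_square
    by (intro sum.cong refl, subst (2) r_def) (simp add: sum_distrib_left mult_ac)
  have B2: "(\<Sum>i<n. \<Sum>j<n. m i j * (v i * r j)) = B"
    by (subst sum.swap, subst B1[symmetric], intro sum.cong refl) (auto simp: sym mult_ac)
  have expand: "(\<Sum>i<n. \<Sum>j<n. m i j * ((v i + t * r i) * (v j + t * r j))) = 2 * t * B + t\<^sup>2 * c"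
    for t
  proof -
    have "(\<Sum>i<n. \<Sum>j<n. m i j * ((v i + t * r i) * (v j + t * r j))) =
      (\<Sum>i<n. \<Sum>j<n. m i j * (v i * v j)) + t * (\<Sum>i<n. \<Sum>j<n. m i j * (r i * v j))
      + t * (\<Sum>i<n. \<Sum>j<n. m i j * (v i * r j)) + t\<^sup>2 * (\<Sum>i<n. \<Sum>j<n. m i j * (r i * r j))"
      unfolding sum_distrib_left sum.distrib[symmetric]
      by (intro sum.cong refl) (simp add: algebra_simps power2_eq_square)
    then show ?thesis
      by (simp add: zero B1 B2 c_def)
  qed
  have c0: "c \<ge> 0"
    using psd[of r] by (simp add: c_def)
  have B0: "B \<ge> 0"
    by (simp add: B_def sum_nonneg)
  have "B = 0"
  proof (rule ccontr)
    assume "B \<noteq> 0"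
    then have Bpos: "B > 0"
      using B0 by simp
    \<comment> \<open>The minimizer \<open>-B / c\<close> of the quadratic in \<open>t\<close>, adjusted to allow \<open>c = 0\<close>.\<close>
    define t where "t = - B / (c + 1)"
    have tc: "t * (c + 1) = - B"
      using c0 by (simp add: t_def)
    have "t * B < 0"
      using Bpos c0 by (simp add: t_def mult_neg_pos divide_neg_pos)
    have "0 \<le> 2 * t * B + t\<^sup>2 * c"
      using psd[of "\<lambda>i. v i + t * r i"] unfolding expand .
    also have "\<dots> = 2 * t * B + t * (t * (c + 1)) - t\<^sup>2"
      by (simp add: algebra_simps power2_eq_square)
    also have "\<dots> = t * B - t\<^sup>2"
      unfolding tc by simp
    also have "\<dots> < 0"
      using \<open>t * B < 0\<close> zero_le_power2[of t] by linarith
    finally show False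
      by simp
  qed
  then have "(r i)\<^sup>2 = 0"
    using \<open>i < n\<close> unfolding B_def by (subst (asm) sum_nonneg_eq_0_iff) auto
  then show ?thesis
    by (simp add: r_def)
qed

text \<open>
  The sphere is realised inside the product space \<open>nat \<Rightarrow> real\<close>, as sequences supported below \<open>n\<close>;
  it is compact there as a closed part of a product of compact intervals.
\<close>
lemma compact_unit_sphere_below:
  "compact {w :: nat \<Rightarrow> real. (\<forall>i\<ge>n. w i = 0) \<and> (\<Sum>i<n. (w i)\<^sup>2) = 1}" (is "compact ?S")
proof -
  define K where "K = PiE UNIV (\<lambda>i::nat. if i < n then {-1..1::real} else {0})"
  have "compactin (product_topology (\<lambda>i. euclidean) UNIV) K"
    unfolding K_def by (subst compactin_PiE) auto
  then have K: "compact K"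
    by (simp add: euclidean_product_topology)
  have cont: "continuous_on UNIV (\<lambda>w :: nat \<Rightarrow> real. w i)" for i
    by (rule continuous_on_product_coordinates)
  have "closed {w :: nat \<Rightarrow> real. (\<Sum>i<n. (w i)\<^sup>2) = 1}"
    by (intro closed_Collect_eq continuous_intros cont)
  moreover have "?S = K \<inter> {w. (\<Sum>i<n. (w i)\<^sup>2) = 1}"
  proof (intro equalityI subsetI)
    fix w assume w: "w \<in> ?S"
    have "w i \<in> {-1..1}" if "i < n" for i
    proof -
      have "(w i)\<^sup>2 \<le> (\<Sum>i<n. (w i)\<^sup>2)"
        using that by (intro member_le_sum) auto
      then have "\<bar>w i\<bar> \<le> 1"
        using w by (simp add: abs_square_le_1)
      then show ?thesis
        by auto
    qed
    then show "w \<in> K \<inter> {w. (\<Sum>i<n. (w i)\<^sup>2) = 1}"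
      using w by (auto simp: K_def PiE_iff)
  next
    fix w assume w: "w \<in> K \<inter> {w. (\<Sum>i<n. (w i)\<^sup>2) = 1}"
    have "w i = 0" if "i \<ge> n" for i
    proof -
      have "w i \<in> (if i < n then {-1..1} else {0})"
        using w unfolding K_def by blast
      then show ?thesis
        using that by simp
    qed
    then show "w \<in> ?S"
      using w by simp
  qed
  ultimately show ?thesis
    using compact_Int_closed[OF K] by simp
qed

text \<open>
  The eigenvalue is the minimum of the form on the sphere, the eigenvector a point where it is
  attained; the lower bound for arbitrary \<open>w\<close> follows by homogeneity.
\<close>
lemma symmetric_form_min_eigenvalue:
  fixes a :: "nat \<Rightarrow> nat \<Rightarrow> real"
  assumes "n > 0" and sym: "\<And>i j. i < n \<Longrightarrow> j < n \<Longrightarrow> a i j = a j i"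
  obtains \<mu> v where "\<exists>i<n. v i \<noteq> 0"
    and "\<And>i. i < n \<Longrightarrow> (\<Sum>j<n. a i j * v j) = \<mu> * v i"
    and "\<And>w. \<mu> * (\<Sum>i<n. (w i)\<^sup>2) \<le> (\<Sum>i<n. \<Sum>j<n. a i j * (w i * w j))"
proof -
  define S where "S = {w :: nat \<Rightarrow> real. (\<forall>i\<ge>n. w i = 0) \<and> (\<Sum>i<n. (w i)\<^sup>2) = 1}"
  define Q where "Q w = (\<Sum>i<n. \<Sum>j<n. a i j * (w i * w j))" for w
  have "compact S"
    unfolding S_def by (rule compact_unit_sphere_below)
  moreover have "(\<lambda>i. if i = 0 then 1 else 0) \<in> S"
    using \<open>n > 0\<close> by (simp add: S_def if_distrib[of "\<lambda>x. x\<^sup>2"] cong: if_cong)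
  then have "S \<noteq> {}"
    by blast
  moreover have "continuous_on S Q"
  proof -
    have "continuous_on S (\<lambda>w :: nat \<Rightarrow> real. w i)" for i
      by (rule continuous_on_subset[OF continuous_on_product_coordinates]) simp
    then show ?thesis
      unfolding Q_def by (intro continuous_intros)
  qed
  ultimately obtain v where v: "v \<in> S" "\<And>w. w \<in> S \<Longrightarrow> Q v \<le> Q w"
    using continuous_attains_inf[of S Q] by metis
  define \<mu> where "\<mu> = Q v"
  have lower: "\<mu> * (\<Sum>i<n. (w i)\<^sup>2) \<le> Q w" for w
  proof (cases "(\<Sum>i<n. (w i)\<^sup>2) = 0")
    case True
    then have "w i = 0" if "i < n" for i
      using that by (subst (asm) sum_nonneg_eq_0_iff) auto
    then show ?thesis
      by (simp add: True Q_def)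
  next
    case False
    define N where "N = (\<Sum>i<n. (w i)\<^sup>2)"
    have "N > 0"
      using False unfolding N_def by (simp add: sum_nonneg order.not_eq_order_implies_strict)
    define u where "u i = (if i < n then w i / sqrt N else 0)" for i
    have "(\<Sum>i<n. (u i)\<^sup>2) = (\<Sum>i<n. (w i)\<^sup>2) / N"
      using \<open>N > 0\<close> by (simp add: u_def power_divide sum_divide_distrib)
    then have "u \<in> S"
      using \<open>N > 0\<close> by (simp add: S_def u_def N_def)
    moreover have "Q u = Q w / N"
      using \<open>N > 0\<close> by (simp add: u_def Q_def sum_divide_distrib)
    ultimately have "\<mu> \<le> Q w / N"
      using v(2) unfolding \<mu>_def by metis
    then show ?thesis
      using \<open>N > 0\<close> by (simp add: N_def pos_le_divide_eq)
  qed
  define m where "m i j = a i j - (if i = j then \<mu> else 0)" for i j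
  have m_form: "(\<Sum>i<n. \<Sum>j<n. m i j * (w i * w j)) = Q w - \<mu> * (\<Sum>i<n. (w i)\<^sup>2)" for w
    by (simp add: m_def Q_def left_diff_distrib sum_subtractf if_distrib[of "\<lambda>x. x * _"]
        power2_eq_square sum_distrib_left cong: if_cong)
  have "(\<Sum>j<n. m i j * v j) = 0" if "i < n" for i
  proof (rule psd_form_zero_imp_kernel[OF _ _ _ that])
    show "m i j = m j i" if "i < n" "j < n" for i j
      using sym[OF that] by (simp add: m_def)
    show "0 \<le> (\<Sum>i<n. \<Sum>j<n. m i j * (w i * w j))" for w
      using lower[of w] by (simp add: m_form)
    show "(\<Sum>i<n. \<Sum>j<n. m i j * (v i * v j)) = 0"
      using v(1) by (simp add: m_form \<mu>_def S_def)
  qed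
  then have "(\<Sum>j<n. a i j * v j) = \<mu> * v i" if "i < n" for i
    using that by (simp add: m_def left_diff_distrib sum_subtractf if_distrib[of "\<lambda>x. x * _"]
        cong: if_cong)
  moreover have "\<exists>i<n. v i \<noteq> 0"
  proof (rule ccontr)
    assume "\<not> (\<exists>i<n. v i \<noteq> 0)"
    then show False
      using v(1) by (simp add: S_def)
  qed
  ultimately show thesis
    using that[of v \<mu>] lower by (simp add: Q_def)
qed

lemma lambda_min_times_norm_le_form:
  fixes a :: "nat \<Rightarrow> nat \<Rightarrow> real"
  assumes "n > 0" and "\<And>i j. i < n \<Longrightarrow> j < n \<Longrightarrow> a i j = a j i"
  shows "lambda_min (Matrix.mat n n (\<lambda>(i, j). a i j)) * (\<Sum>i<n. (w i)\<^sup>2)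
         \<le> (\<Sum>i<n. \<Sum>j<n. a i j * (w i * w j))"
proof -
  define A where "A = Matrix.mat n n (\<lambda>(i, j). a i j)"
  have A: "A \<in> carrier_mat n n"
    by (simp add: A_def)
  obtain \<mu> v where nz: "\<exists>i<n. v i \<noteq> 0"
    and ev: "\<And>i. i < n \<Longrightarrow> (\<Sum>j<n. a i j * v j) = \<mu> * v i"
    and low: "\<And>w. \<mu> * (\<Sum>i<n. (w i)\<^sup>2) \<le> (\<Sum>i<n. \<Sum>j<n. a i j * (w i * w j))"
    by (rule symmetric_form_min_eigenvalue[where a = a, OF assms]) (assumption, assumption, rule that)
  have "eigenvector A (Matrix.vec n v) \<mu>"
    unfolding eigenvector_def
  proof (intro conjI)
    show "Matrix.vec n v \<in> carrier_vec (dim_row A)"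
      by (simp add: A_def)
    obtain i where "i < n" "v i \<noteq> 0"
      using nz by blast
    then have "vec_index (Matrix.vec n v) i \<noteq> vec_index (0\<^sub>v (dim_row A)) i"
      by (simp add: A_def)
    then show "Matrix.vec n v \<noteq> 0\<^sub>v (dim_row A)"
      by metis
    show "A *\<^sub>v Matrix.vec n v = \<mu> \<cdot>\<^sub>v Matrix.vec n v"
      by (intro eq_vecI) (auto simp: A_def scalar_prod_def atLeast0LessThan ev)
  qed
  then have "\<mu> \<in> spectrum A"
    unfolding spectrum_def eigenvalue_def by blast
  then have "lambda_min A \<le> \<mu>"
    unfolding lambda_min_def using card_finite_spectrum(1)[OF A] by simp
  then have "lambda_min A * (\<Sum>i<n. (w i)\<^sup>2) \<le> \<mu> * (\<Sum>i<n. (w i)\<^sup>2)"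
    by (simp add: mult_right_mono sum_nonneg)
  then show ?thesis
    using low[of w] unfolding A_def by linarith
qed

section \<open>The quadratic form of a sinc matrix\<close>

lemma has_integral_cos_sinc: "((\<lambda>u. cos (y * u)) has_integral sinc y) {0..1}"
proof (cases "y = 0")
  case True
  then show ?thesis
    using has_integral_const_real[of "1::real" 0 1] by simp
next
  case False
  have "((\<lambda>u. cos (y * u)) has_integral (sin (y * 1) / y - sin (y * 0) / y)) {0..1}"
    using False by (intro fundamental_theorem_of_calculus)
      (auto intro!: derivative_eq_intros simp: has_real_derivative_iff_has_vector_derivative[symmetric])
  then show ?thesis
    using False by simp
qed

lemma cmod_exponential_sum_squared:
  fixes c x :: "nat \<Rightarrow> real"
  shows "(cmod (\<Sum>i\<in>I. c i * cis (x i)))\<^sup>2 = (\<Sum>i\<in>I. \<Sum>j\<in>I. cos (x i - x j) * (c i * c j))"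
proof -
  have "(\<Sum>i\<in>I. \<Sum>j\<in>I. cos (x i - x j) * (c i * c j)) =
    (\<Sum>i\<in>I. c i * cos (x i))\<^sup>2 + (\<Sum>i\<in>I. c i * sin (x i))\<^sup>2"
    unfolding power2_eq_square sum_product sum.distrib[symmetric]
    by (intro sum.cong refl) (simp add: cos_diff algebra_simps)
  then show ?thesis
    by (simp add: cmod_power2)
qed

text \<open>
  Each entry is a mean of cosines by \<open>has_integral_cos_sinc\<close>, and a quadratic form with entries
  \<open>cos (x\<^sub>i - x\<^sub>j)\<close> is a squared modulus.
\<close>
lemma sinc_form_has_integral:
  fixes c t :: "nat \<Rightarrow> real"
  assumes "finite I"
  shows "((\<lambda>u. (cmod (\<Sum>i\<in>I. c i * cis (t i * u)))\<^sup>2) has_integral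
    (\<Sum>i\<in>I. \<Sum>j\<in>I. sinc (t i - t j) * (c i * c j))) {0..1}"
  unfolding cmod_exponential_sum_squared left_diff_distrib[symmetric]
  by (intro has_integral_sum has_integral_mult_left has_integral_cos_sinc assms)

lemma binomial_exponential_sum:
  "(\<Sum>k\<le>m. ((-1) ^ k * real (m choose k)) * cis (real k * \<phi>)) = (1 - cis \<phi>) ^ m"
proof -
  have "(1 - cis \<phi>) ^ m = (- cis \<phi> + 1) ^ m"
    by simp
  also have "\<dots> = (\<Sum>k\<le>m. of_nat (m choose k) * (- cis \<phi>) ^ k)"
    by (subst binomial_ring) simp
  also have "\<dots> = (\<Sum>k\<le>m. ((-1) ^ k * real (m choose k)) * cis (real k * \<phi>))"
    by (intro sum.cong refl, subst power_minus) (simp add: Complex.DeMoivre)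
  finally show ?thesis ..
qed

lemma cmod_one_minus_cis_le: "cmod (1 - cis \<phi>) \<le> \<bar>\<phi>\<bar>"
proof -
  have "cmod (1 - cis \<phi>) = 2 * \<bar>sin (\<phi> / 2)\<bar>"
    using dist_exp_i_1[of \<phi>] by (simp add: cis_conv_exp norm_minus_commute)
  also have "\<dots> \<le> \<bar>\<phi>\<bar>"
    using abs_sin_x_le_abs_x[of "\<phi> / 2"] by simp
  finally show ?thesis .
qed

text \<open>
  The left-hand side is, up to sign, the central difference of order \<open>2 m\<close> of \<open>sinc\<close> at \<open>0\<close> with
  step \<open>\<theta>\<close>, hence small of that order; the integral representation gives the constant \<open>1\<close>.
\<close>
lemma sinc_form_binomial_le:
  fixes \<theta> :: real
  assumes "\<theta> \<ge> 0"
  shows "(\<Sum>i\<le>m. \<Sum>j\<le>m. sinc (real i * \<theta> - real j * \<theta>) *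
    (((-1) ^ i * real (m choose i)) * ((-1) ^ j * real (m choose j)))) \<le> \<theta> ^ (2 * m)"
proof -
  have form: "((\<lambda>u. (cmod ((1 - cis (\<theta> * u)) ^ m))\<^sup>2) has_integral
    (\<Sum>i\<le>m. \<Sum>j\<le>m. sinc (real i * \<theta> - real j * \<theta>) *
    (((-1) ^ i * real (m choose i)) * ((-1) ^ j * real (m choose j))))) {0..1}"
    using sinc_form_has_integral[of "{..m}" "\<lambda>i. (-1) ^ i * real (m choose i)" "\<lambda>i. real i * \<theta>"]
    unfolding binomial_exponential_sum[symmetric] by (simp add: mult.assoc)
  have const: "((\<lambda>u. \<theta> ^ (2 * m)) has_integral \<theta> ^ (2 * m)) {0..1::real}"
    using has_integral_const_real[of "\<theta> ^ (2 * m)" 0 1] by simp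
  show ?thesis
  proof (rule has_integral_le[OF form const])
    fix u :: real assume u: "u \<in> {0..1}"
    have "cmod (1 - cis (\<theta> * u)) \<le> \<bar>\<theta> * u\<bar>"
      by (rule cmod_one_minus_cis_le)
    also have "\<dots> \<le> \<theta>"
      using u assms by (simp add: abs_mult mult_left_le)
    finally have "cmod (1 - cis (\<theta> * u)) ^ (m * 2) \<le> \<theta> ^ (m * 2)"
      by (intro power_mono) auto
    then show "(cmod ((1 - cis (\<theta> * u)) ^ m))\<^sup>2 \<le> \<theta> ^ (2 * m)"
      by (simp add: norm_power power_mult[symmetric] mult.commute)
  qed
qed

section \<open>The extremal configuration\<close>

text \<open>
  Indices below \<open>l\<close> give the cluster. The indices from \<open>l\<close> on give isolated nodes; the shift by one
  keeps the first of them at distance \<open>\<rho>\<close> from the cluster node \<open>0\<close>.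
\<close>
definition extremal_node :: "real \<Rightarrow> real \<Rightarrow> nat \<Rightarrow> nat \<Rightarrow> real" where
  "extremal_node \<Delta> \<rho> l i = (if i < l then real i * \<Delta> else - ((real (i - l) + 1) * \<rho>))"

lemma wrap_norm_eq_abs: "\<bar>t\<bar> < pi \<Longrightarrow> wrap_norm t = \<bar>t\<bar>"
  by (simp add: wrap_norm_def Arg_exp abs_less_iff)

lemma abs_diff_of_nat_ge_one:
  assumes "i \<noteq> j"
  shows "1 \<le> \<bar>real i - real j\<bar>"
  using assms by (cases "i < j") auto

lemma cluster_node_distance:
  assumes "i < l" "j < l" "i \<noteq> j" "\<Delta> > 0"
  shows "\<Delta> \<le> \<bar>extremal_node \<Delta> \<rho> l i - extremal_node \<Delta> \<rho> l j\<bar>"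
    and "\<bar>extremal_node \<Delta> \<rho> l i - extremal_node \<Delta> \<rho> l j\<bar> \<le> (real l - 1) * \<Delta>"
proof -
  have *: "\<bar>extremal_node \<Delta> \<rho> l i - extremal_node \<Delta> \<rho> l j\<bar> = \<bar>real i - real j\<bar> * \<Delta>"
    using assms by (simp add: extremal_node_def left_diff_distrib[symmetric] abs_mult)
  show "\<Delta> \<le> \<bar>extremal_node \<Delta> \<rho> l i - extremal_node \<Delta> \<rho> l j\<bar>"
    unfolding * using abs_diff_of_nat_ge_one[OF assms(3)] assms(4) by simp
  have "\<bar>real i - real j\<bar> \<le> real l - 1"
    using assms(1,2) by linarith
  then show "\<bar>extremal_node \<Delta> \<rho> l i - extremal_node \<Delta> \<rho> l j\<bar> \<le> (real l - 1) * \<Delta>"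
    unfolding * using assms(4) by simp
qed

lemma isolated_node_distance:
  assumes "l \<le> i" "j \<noteq> i" "\<Delta> > 0" "\<rho> > 0"
  shows "\<rho> \<le> \<bar>extremal_node \<Delta> \<rho> l i - extremal_node \<Delta> \<rho> l j\<bar>"
proof (cases "j < l")
  case True
  have "0 \<le> real (i - l) * \<rho>" "0 \<le> real j * \<Delta>"
    using assms by simp_all
  then show ?thesis
    using True assms(1) by (simp add: extremal_node_def algebra_simps)
next
  case False
  have "\<bar>extremal_node \<Delta> \<rho> l i - extremal_node \<Delta> \<rho> l j\<bar> = \<bar>real (j - l) - real (i - l)\<bar> * \<bar>\<rho>\<bar>"
    unfolding abs_mult[symmetric] using False assms(1) 
    by (simp add: extremal_node_def algebra_simps)
  moreover have "1 \<le> \<bar>real (j - l) - real (i - l)\<bar>"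
    using False assms by (intro abs_diff_of_nat_ge_one) auto
  ultimately show ?thesis
    using assms(4) by simp
qed

lemma extremal_node_range:
  assumes "2 \<le> l" "i < s" "0 < \<Delta>" "\<Delta> < pi / (2 * (real l - 1))" "l \<le> s"
  shows "extremal_node \<Delta> (pi / (2 * (real (s - l) + 1))) l i \<in> {- (pi / 2) <..< pi / 2}"
proof (cases "i < l")
  case True
  have "real i * \<Delta> \<le> (real l - 1) * \<Delta>"
    using True assms(3) by (intro mult_right_mono) auto
  also have "\<dots> < pi / 2"
    using assms(1,4) by (simp add: field_simps)
  finally have "real i * \<Delta> < pi / 2" .
  moreover have "0 \<le> real i * \<Delta>"
    using assms(3) by simp
  ultimately show ?thesis
    using True by (auto simp: extremal_node_def intro: less_le_trans[of _ 0])
next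
  case False
  have "real (i - l) + 1 < real (s - l) + 1"
    using False assms(2) by simp
  then have "(real (i - l) + 1) * (pi / (2 * (real (s - l) + 1)))
    < (real (s - l) + 1) * (pi / (2 * (real (s - l) + 1)))"
    by (intro mult_strict_right_mono) (simp_all add: add_nonneg_pos)
  also have "\<dots> = pi / 2"
    using of_nat_0_le_iff[of "s - l"] by (simp add: field_simps del: of_nat_0_le_iff)
  finally have "(real (i - l) + 1) * (pi / (2 * (real (s - l) + 1))) < pi / 2" .
  moreover have "0 < (real (i - l) + 1) * (pi / (2 * (real (s - l) + 1)))"
    by (intro mult_pos_pos divide_pos_pos) (simp_all add: add_nonneg_pos)
  ultimately show ?thesis
    using False pi_gt_zero unfolding extremal_node_def by (auto intro: less_trans[of _ 0])
qed

text \<open>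
  The set attached to a cluster node is the whole cluster, whose diameter \<open>(l - 1) \<Delta>\<close> dictates
  \<open>\<tau> = l - 1\<close>; the set attached to an isolated node is that node alone.
\<close>
lemma clustered_configuration_extremal:
  assumes "2 \<le> l" "l \<le> s" "0 < \<Delta>" "\<Delta> < pi / (2 * (real l - 1))"
  defines "\<rho> \<equiv> pi / (2 * (real (s - l) + 1))"
  shows "clustered_configuration \<Delta> \<rho> s l (real l - 1) (map (extremal_node \<Delta> \<rho> l) [0..<s])"
proof -
  let ?t = "extremal_node \<Delta> \<rho> l"
  have rho: "\<rho> > 0"
    by (simp add: \<rho>_def add_nonneg_pos)
  have range: "?t i \<in> {- (pi / 2) <..< pi / 2}" if "i < s" for i
    unfolding \<rho>_def using assms that by (intro extremal_node_range) auto
  have wrap: "wrap_norm (?t j - ?t i) = \<bar>?t i - ?t j\<bar>" if "i < s" "j < s" for i j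
    using range[OF that(1)] range[OF that(2)] by (subst wrap_norm_eq_abs) (auto simp: abs_if)
  have far: "\<rho> \<le> \<bar>?t i - ?t j\<bar>" if "i \<noteq> j" "l \<le> i \<or> l \<le> j" for i j
    using that isolated_node_distance[of l i j \<Delta> \<rho>] isolated_node_distance[of l j i \<Delta> \<rho>] rho assms(3)
    by (auto simp: abs_minus_commute)
  have inj: "?t i \<noteq> ?t j" if "i \<noteq> j" for i j
    using that far[of i j] cluster_node_distance(1)[of i l j \<Delta> \<rho>] rho assms(3)
    by (cases "l \<le> i \<or> l \<le> j") auto
  have tau: "real l - 1 < pi / \<Delta>"
  proof -
    have "(real l - 1) * \<Delta> < pi / 2"
      using assms(1,4) by (simp add: field_simps)
    also have "pi / 2 < pi"
      by simp
    finally show ?thesis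
      using assms(3) by (simp add: field_simps)
  qed
  have set_eq: "set (map ?t [0..<s]) = ?t ` {..<s}"
    by (simp add: atLeast0LessThan)
  have clusters: "\<exists>K. K \<subseteq> ?t ` {..<s} \<and> ?t i \<in> K \<and> card K \<le> l \<and>
        (\<forall>y \<in> K - {?t i}. \<Delta> \<le> wrap_norm (y - ?t i) \<and> wrap_norm (y - ?t i) \<le> (real l - 1) * \<Delta>) \<and>
        (\<forall>y \<in> ?t ` {..<s} - K. \<rho> \<le> wrap_norm (y - ?t i))" if "i < s" for i
  proof (cases "i < l")
    case True
    have "card (?t ` {..<l}) \<le> l"
      using card_image_le[of "{..<l}" ?t] by simp
    moreover have "\<Delta> \<le> wrap_norm (y - ?t i) \<and> wrap_norm (y - ?t i) \<le> (real l - 1) * \<Delta>"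
      if y: "y \<in> ?t ` {..<l} - {?t i}" for y
    proof -
      obtain j where "j < l" "y = ?t j" "i \<noteq> j"
        using y by auto
      then show ?thesis
        using wrap[of i j] \<open>i < s\<close> \<open>l \<le> s\<close> True assms(3) cluster_node_distance[of i l j \<Delta> \<rho>] by simp
    qed
    moreover have "\<rho> \<le> wrap_norm (y - ?t i)" if y: "y \<in> ?t ` {..<s} - ?t ` {..<l}" for y
    proof -
      obtain j where "j < s" "y = ?t j" "\<not> j < l"
        using y by auto
      then show ?thesis
        using wrap[of i j] \<open>i < s\<close> True far[of i j] by simp
    qed
    ultimately show ?thesis
      using True \<open>l \<le> s\<close> by (intro exI[of _ "?t ` {..<l}"]) auto
  next
    case False
    have "\<rho> \<le> wrap_norm (y - ?t i)" if y: "y \<in> ?t ` {..<s} - {?t i}" for y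
    proof -
      obtain j where "j < s" "y = ?t j" "i \<noteq> j"
        using y by auto
      then show ?thesis
        using wrap[of i j] \<open>i < s\<close> False far[of i j] by simp
    qed
    then show ?thesis
      using \<open>i < s\<close> \<open>2 \<le> l\<close> by (intro exI[of _ "{?t i}"]) auto
  qed
  have "distinct (map ?t [0..<s])"
    using inj by (auto simp: distinct_map inj_on_def)
  moreover have "?t ` {..<s} \<subseteq> {- (pi / 2) <.. pi / 2}"
    using range by (auto simp: less_imp_le)
  ultimately show ?thesis
    unfolding clustered_configuration_def set_eq
    using assms(1-3) rho tau clusters by auto
qed

text \<open>
  The Rayleigh quotient is taken at the alternating binomial vector on the cluster, extended by
  zero, so that only the cluster block of the matrix enters.
\<close>
lemma lambda_min_extremal_le:
  assumes "2 \<le> l" "l \<le> s" "0 \<le> \<Delta> * \<Omega>"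
  shows "lambda_min (sinc_matrix (map (extremal_node \<Delta> \<rho> l) [0..<s]) \<Omega>)
    \<le> (\<Delta> * \<Omega>) ^ (2 * (l - 1))"
proof -
  define t where "t = extremal_node \<Delta> \<rho> l"
  define a where "a i j = sinc (\<Omega> * (t i - t j))" for i j
  define w where "w i = (if i < l then (-1) ^ i * real ((l - 1) choose i) else 0)" for i
  define L where "L = lambda_min (sinc_matrix (map t [0..<s]) \<Omega>)"
  have mat: "sinc_matrix (map t [0..<s]) \<Omega> = Matrix.mat s s (\<lambda>(i, j). a i j)"
    by (intro eq_matI) (auto simp: sinc_matrix_def a_def)
  have "a i j = a j i" for i j
  proof -
    have "\<Omega> * (t j - t i) = - (\<Omega> * (t i - t j))"
      by (simp add: algebra_simps)
    then show ?thesis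
      by (simp only: a_def sinc_neg)
  qed
  then have "L * (\<Sum>i<s. (w i)\<^sup>2) \<le> (\<Sum>i<s. \<Sum>j<s. a i j * (w i * w j))"
    unfolding L_def mat using assms(1,2) by (intro lambda_min_times_norm_le_form) auto
  also have "\<dots> = (\<Sum>i<l. \<Sum>j<s. a i j * (w i * w j))"
    using assms(2) by (intro sum.mono_neutral_right) (auto simp: w_def)
  also have "\<dots> = (\<Sum>i<l. \<Sum>j<l. a i j * (w i * w j))"
    using assms(2) by (intro sum.cong refl sum.mono_neutral_right) (auto simp: w_def)
  also have "{..<l} = {..l - 1}"
    using assms(1) by auto
  also have "(\<Sum>i\<le>l - 1. \<Sum>j\<le>l - 1. a i j * (w i * w j)) =
    (\<Sum>i\<le>l - 1. \<Sum>j\<le>l - 1. sinc (real i * (\<Delta> * \<Omega>) - real j * (\<Delta> * \<Omega>)) *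
    (((-1) ^ i * real ((l - 1) choose i)) * ((-1) ^ j * real ((l - 1) choose j))))"
  proof (intro sum.cong refl)
    fix i j assume "i \<in> {..l - 1}" "j \<in> {..l - 1}"
    then have "i < l" "j < l"
      using assms(1) by auto
    moreover have "\<Omega> * (real i * \<Delta> - real j * \<Delta>) = real i * (\<Delta> * \<Omega>) - real j * (\<Delta> * \<Omega>)"
      by (simp add: algebra_simps)
    ultimately show "a i j * (w i * w j) = sinc (real i * (\<Delta> * \<Omega>) - real j * (\<Delta> * \<Omega>)) *
      (((-1) ^ i * real ((l - 1) choose i)) * ((-1) ^ j * real ((l - 1) choose j)))"
      by (simp only: a_def w_def t_def extremal_node_def if_True)
  qed
  also have "\<dots> \<le> (\<Delta> * \<Omega>) ^ (2 * (l - 1))"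
    using assms(3) by (rule sinc_form_binomial_le)
  finally have upper: "L * (\<Sum>i<s. (w i)\<^sup>2) \<le> (\<Delta> * \<Omega>) ^ (2 * (l - 1))" .
  have "(w 0)\<^sup>2 \<le> (\<Sum>i<s. (w i)\<^sup>2)"
    using assms(1,2) by (intro member_le_sum) auto
  then have norm: "1 \<le> (\<Sum>i<s. (w i)\<^sup>2)"
    using assms(1) by (simp add: w_def)
  have "L \<le> (\<Delta> * \<Omega>) ^ (2 * (l - 1))"
  proof (cases "L \<le> 0")
    case True
    moreover have "0 \<le> (\<Delta> * \<Omega>) ^ (2 * (l - 1))"
      using assms(3) by simp
    ultimately show ?thesis
      by linarith
  next
    case False
    then have "L * 1 \<le> L * (\<Sum>i<s. (w i)\<^sup>2)"
      using norm by (intro mult_left_mono) auto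
    then show ?thesis
      using upper by simp
  qed
  then show ?thesis
    by (simp add: L_def t_def)
qed

theorem theorem3p9:
  shows "\<exists>\<eta>::real. 0 < \<eta> \<and> \<eta> < 1 \<and>
    (\<forall>l::nat. 2 \<le> l \<longrightarrow>
      (\<exists>C::real. \<forall>s::nat. l \<le> s \<longrightarrow>
        (\<exists>\<rho>' \<tau>' :: real. \<forall>\<Delta>::real. 0 < \<Delta> \<and> \<Delta> < pi / (2 * (real l - 1)) \<longrightarrow>
          (\<exists>x_min :: real list. clustered_configuration \<Delta> \<rho>' s l \<tau>' x_min \<and>
            (\<forall>\<Omega>::real. 0 < \<Omega> \<and> \<Delta> * \<Omega> < \<eta> \<longrightarrow>
              lambda_min (sinc_matrix x_min \<Omega>) \<le> C * (\<Delta> * \<Omega>) ^ (2 * (l - 1)))))))"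
proof (rule exI[of _ "1/2"], intro conjI allI impI)
  fix l :: nat assume l: "2 \<le> l"
  show "\<exists>C::real. \<forall>s::nat. l \<le> s \<longrightarrow>
        (\<exists>\<rho>' \<tau>' :: real. \<forall>\<Delta>::real. 0 < \<Delta> \<and> \<Delta> < pi / (2 * (real l - 1)) \<longrightarrow>
          (\<exists>x_min :: real list. clustered_configuration \<Delta> \<rho>' s l \<tau>' x_min \<and>
            (\<forall>\<Omega>::real. 0 < \<Omega> \<and> \<Delta> * \<Omega> < 1/2 \<longrightarrow>
              lambda_min (sinc_matrix x_min \<Omega>) \<le> C * (\<Delta> * \<Omega>) ^ (2 * (l - 1)))))"
  proof (rule exI[of _ 1], intro allI impI)
    fix s :: nat assume s: "l \<le> s"
    define \<rho> where "\<rho> = pi / (2 * (real (s - l) + 1))"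
    have "\<exists>x_min. clustered_configuration \<Delta> \<rho> s l (real l - 1) x_min \<and>
            (\<forall>\<Omega>. 0 < \<Omega> \<and> \<Delta> * \<Omega> < 1/2 \<longrightarrow>
              lambda_min (sinc_matrix x_min \<Omega>) \<le> 1 * (\<Delta> * \<Omega>) ^ (2 * (l - 1)))"
      if "0 < \<Delta> \<and> \<Delta> < pi / (2 * (real l - 1))" for \<Delta> :: real
      using that l s clustered_configuration_extremal[of l s \<Delta>] lambda_min_extremal_le[of l s \<Delta> _ \<rho>]
      by (intro exI[of _ "map (extremal_node \<Delta> \<rho> l) [0..<s]"]) (simp add: \<rho>_def)
    then show "\<exists>\<rho>' \<tau>' :: real. \<forall>\<Delta>::real. 0 < \<Delta> \<and> \<Delta> < pi / (2 * (real l - 1)) \<longrightarrow>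
          (\<exists>x_min :: real list. clustered_configuration \<Delta> \<rho>' s l \<tau>' x_min \<and>
            (\<forall>\<Omega>::real. 0 < \<Omega> \<and> \<Delta> * \<Omega> < 1/2 \<longrightarrow>
              lambda_min (sinc_matrix x_min \<Omega>) \<le> 1 * (\<Delta> * \<Omega>) ^ (2 * (l - 1))))"
      by blast
  qed
qed simp_all

end
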